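(* Let $f_1\in\mathcal F_{\mu_1,L_1}$ and $f_2\in\mathcal F_{\mu_2,L_2}$ be functions on $\mathbb R^d$ satisfying the standing assumption (A) of the context, with $L_1>\mu_2\ge\mu_1\ge 0$, and let $F=f_1-f_2$. Then after two DCA iterations connecting $x^k$, $x^{k+1}$ and $x^{k+2}$ (with $x^k\in\operatorname{dom}\partial f_1$) it holds $$F(x^{k+1})-F(x^{k+2})\;\ge\;\mu_2\frac{\mu_2-\mu_1}{L_1-\mu_1}\,\frac12\|x^k-x^{k+1}\|^2+\Big(\mu_2+\mu_1\frac{L_1-\mu_2}{L_1-\mu_1}\Big)\frac12\|x^{k+1}-x^{k+2}\|^2 .$$
   Context: Function class. For $\mu\in\mathbb R$ and $L\in(\mu,\infty]$, $\mathcal F_{\mu,L}$ denotes the set of proper, lower semicontinuous functions $f:\mathbb R^d\to\mathbb R\cup\{+\infty\}$ such that $f-\frac{\mu}{2}\|\cdot\|^2$ is convex and, if $L<\infty$, $f$ is finite-valued and $\frac L2\|\cdot\|^2-f$ is convex (no condition on the upper curvature if $L=\infty$). Expressions in which some $L_i=\infty$ are understood as limits $L_i\to\infty$. Subdifferential. For convex $f$, $\partial f(x)$ is the usual convex subdifferential. For $f\in\mathcal F_{\mu,L}$ with $\mu<0$, $\partial f(x):=\partial\tilde f(x)+\mu x$ where $\tilde f=f-\frac\mu2\|\cdot\|^2$ is convex. $\operatorname{dom}\partial f=\{x:\partial f(x)\ne\emptyset\}$ and $\operatorname{range}\partial f=\bigcup_x\partial f(x)$. Standing assumption (A). $f_1\in\mathcal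 F_{\mu_1,L_1}$ and $f_2\in\mathcal F_{\mu_2,L_2}$ with $0\le\mu_1<L_1\le\infty$, $\mu_2\in(-\infty,\infty)$, $L_2\in(\mu_2,\infty]$; $F=f_1-f_2$ (with the convention $(+\infty)-(+\infty)=+\infty$) is bounded below; $\emptyset\ne\operatorname{dom}\partial f_1\subseteq\operatorname{dom}\partial f_2$ and $\operatorname{range}\partial f_2\subseteq\operatorname{range}\partial f_1$. DCA (difference-of-convex algorithm). Given $x^k$, one iteration selects any $g_2^k\in\partial f_2(x^k)$ and any $x^{k+1}\in\arg\min_{w\in\mathbb R^d}\{f_1(w)-\langle g_2^k,w\rangle\}$. *)

theory Defs
  imports "HOL-Analysis.Analysis"
begin

text \<open>
  Functions with values in the extended half-line are rendered as functions into \<^typ>\<open>ereal\<close> that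
  never take the value \<open>-\<infinity>\<close> (part of \<open>proper\<close>).
\<close>

definition proper :: "('a \<Rightarrow> ereal) \<Rightarrow> bool" where
  "proper f \<longleftrightarrow> (\<forall>x. f x \<noteq> - \<infinity>) \<and> (\<exists>x. f x \<noteq> \<infinity>)"

definition lsc :: "('a::topological_space \<Rightarrow> ereal) \<Rightarrow> bool" where
  "lsc f \<longleftrightarrow> (\<forall>x. f x \<le> Liminf (at x) f)"

text \<open>Only used for functions without the value \<open>-\<infinity>\<close>, so the sum below is never \<open>\<infinity> - \<infinity>\<close>.\<close>

definition ext_convex :: "('a::real_vector \<Rightarrow> ereal) \<Rightarrow> bool" where
  "ext_convex f \<longleftrightarrow>
     (\<forall>x y u v. 0 \<le> u \<and> 0 \<le> v \<and> u + v = 1 \<longrightarrow>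
        f (u *\<^sub>R x + v *\<^sub>R y) \<le> ereal u * f x + ereal v * f y)"

definition sub_quadratic :: "real \<Rightarrow> ('a::real_normed_vector \<Rightarrow> ereal) \<Rightarrow> 'a \<Rightarrow> ereal" where
  "sub_quadratic \<mu> f = (\<lambda>x. f x - ereal (\<mu> / 2 * (norm x)\<^sup>2))"

definition curvature_class :: "real \<Rightarrow> ereal \<Rightarrow> ('a::euclidean_space \<Rightarrow> ereal) set" where
  "curvature_class \<mu> L =
     {f. proper f \<and> lsc f \<and> ext_convex (sub_quadratic \<mu> f) \<and>
         (L < \<infinity> \<longrightarrow> (\<forall>x. \<bar>f x\<bar> \<noteq> \<infinity>) \<and>
            convex_on UNIV (\<lambda>x. real_of_ereal L / 2 * (norm x)\<^sup>2 - real_of_ereal (f x)))}"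

definition convex_subdifferential :: "('a::real_inner \<Rightarrow> ereal) \<Rightarrow> 'a \<Rightarrow> 'a set" where
  "convex_subdifferential f x =
     {g. \<bar>f x\<bar> \<noteq> \<infinity> \<and> (\<forall>y. f x + ereal (g \<bullet> (y - x)) \<le> f y)}"

definition subdifferential :: "real \<Rightarrow> ('a::real_inner \<Rightarrow> ereal) \<Rightarrow> 'a \<Rightarrow> 'a set" where
  "subdifferential \<mu> f x =
     (if \<mu> < 0 then (\<lambda>g. g + \<mu> *\<^sub>R x) ` convex_subdifferential (sub_quadratic \<mu> f) x
      else convex_subdifferential f x)"

definition subdiff_dom :: "real \<Rightarrow> ('a::real_inner \<Rightarrow> ereal) \<Rightarrow> 'a set" where
  "subdiff_dom \<mu> f = {x. subdifferential \<mu> f x \<noteq> {}}"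

definition subdiff_range :: "real \<Rightarrow> ('a::real_inner \<Rightarrow> ereal) \<Rightarrow> 'a set" where
  "subdiff_range \<mu> f = (\<Union>x. subdifferential \<mu> f x)"

text \<open>
  Subtraction on \<^typ>\<open>ereal\<close> satisfies \<open>\<infinity> - \<infinity> = \<infinity>\<close>, which is the convention wanted for the
  objective \<open>f1 - f2\<close>.
\<close>

definition dc_objective :: "('a \<Rightarrow> ereal) \<Rightarrow> ('a \<Rightarrow> ereal) \<Rightarrow> 'a \<Rightarrow> ereal" where
  "dc_objective f1 f2 x = f1 x - f2 x"

lemma dc_objective_infinity: "f1 x = \<infinity> \<Longrightarrow> f2 x = \<infinity> \<Longrightarrow> dc_objective f1 f2 x = \<infinity>"
  by (simp add: dc_objective_def)

definition dc_assumption ::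
  "real \<Rightarrow> ereal \<Rightarrow> real \<Rightarrow> ereal \<Rightarrow> ('a::euclidean_space \<Rightarrow> ereal) \<Rightarrow> ('a \<Rightarrow> ereal) \<Rightarrow> bool" where
  "dc_assumption \<mu>1 L1 \<mu>2 L2 f1 f2 \<longleftrightarrow>
     0 \<le> \<mu>1 \<and> ereal \<mu>1 < L1 \<and> ereal \<mu>2 < L2 \<and>
     f1 \<in> curvature_class \<mu>1 L1 \<and> f2 \<in> curvature_class \<mu>2 L2 \<and>
     (\<exists>c::real. \<forall>x. ereal c \<le> dc_objective f1 f2 x) \<and>
     subdiff_dom \<mu>1 f1 \<noteq> {} \<and> subdiff_dom \<mu>1 f1 \<subseteq> subdiff_dom \<mu>2 f2 \<and>
     subdiff_range \<mu>2 f2 \<subseteq> subdiff_range \<mu>1 f1"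

definition dca_step ::
  "real \<Rightarrow> ('a::real_inner \<Rightarrow> ereal) \<Rightarrow> ('a \<Rightarrow> ereal) \<Rightarrow> 'a \<Rightarrow> 'a \<Rightarrow> bool" where
  "dca_step \<mu>2 f1 f2 x x' \<longleftrightarrow>
     (\<exists>g \<in> subdifferential \<mu>2 f2 x.
        is_arg_min (\<lambda>w. f1 w - ereal (g \<bullet> w)) (\<lambda>w. w \<in> UNIV) x')"

text \<open>
  Value of an expression \<open>\<phi>\<close> at a curvature bound \<open>L\<close>, read as the limit \<open>L \<rightarrow> \<infinity>\<close> when \<open>L = \<infinity>\<close>.
  Evaluating in \<^typ>\<open>ereal\<close> instead would be wrong, since there \<open>\<infinity> / \<infinity> = 0\<close>.
\<close>

definition at_curvature :: "(real \<Rightarrow> real) \<Rightarrow> ereal \<Rightarrow> real" where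
  "at_curvature \<phi> L = (if L = \<infinity> then Lim at_top \<phi> else \<phi> (real_of_ereal L))"

end

theory Submission
  imports Defs "HOL-Real_Asymp.Real_Asymp"
begin

text \<open>
  Optimality of \<open>x1\<close> and \<open>x2\<close> in the DCA subproblems makes the chosen subgradients \<open>g0\<close>, \<open>g1\<close> of
  \<open>f2\<close> at \<open>x0\<close>, \<open>x1\<close> also subgradients of \<open>f1\<close> at \<open>x1\<close>, \<open>x2\<close>. Put \<open>g = g0 - g1\<close>, \<open>d = x1 - x2\<close>,
  \<open>e = x0 - x1\<close>. The subgradient inequality of \<open>f2\<close> at \<open>x1\<close> and the interpolation inequality of \<open>f1\<close>
  between \<open>x1\<close> and \<open>x2\<close> bound the decrease of the objective below by
  \<open>(\<mu>1 + \<mu>2) / 2 * |d|\<^sup>2 + |g - \<mu>1 d|\<^sup>2 / (2 (L1 - \<mu>1))\<close>. The earlier step enters only through strong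
  monotonicity, \<open>|g| \<ge> \<mu>2 |e|\<close>, and the identity
  \<open>\<mu>2 (|g - \<mu>1 d|\<^sup>2 + \<mu>1 (\<mu>2 - \<mu>1) |d|\<^sup>2) = (\<mu>2 - \<mu>1) |g|\<^sup>2 + \<mu>1 |g - \<mu>2 d|\<^sup>2\<close> converts this into the
  claimed bound. For \<open>L1 = \<infinity>\<close> the term in \<open>e\<close> vanishes in the limit.
\<close>

lemma nonpos_if_le_mult_all_small:
  fixes a c :: real
  assumes "\<And>t. 0 < t \<Longrightarrow> t \<le> 1 \<Longrightarrow> a \<le> c * t"
  shows "a \<le> 0"
proof (rule tendsto_lowerbound)
  show "((\<lambda>t. c * t) \<longlongrightarrow> 0) (at_right 0)"
    by (auto intro!: tendsto_eq_intros)
  show "\<forall>\<^sub>F t in at_right 0. a \<le> c * t"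
    unfolding eventually_at_right_field using assms by (intro exI[of _ 1]) auto
qed simp

lemma norm_convex_combination_sq:
  fixes x y :: "'a::real_inner"
  shows "(norm ((1 - t) *\<^sub>R x + t *\<^sub>R y))\<^sup>2 =
    (1 - t) * (norm x)\<^sup>2 + t * (norm y)\<^sup>2 - t * (1 - t) * (norm (y - x))\<^sup>2"
  unfolding power2_norm_eq_inner
  by (simp add: inner_add_left inner_add_right inner_diff_left inner_diff_right inner_commute[of y x])
    algebra

text \<open>On the segment from \<open>x\<close> to \<open>y\<close>, convexity of
  \<open>sub_quadratic \<mu> f\<close> bounds \<open>f\<close> above and the subgradient bounds it
  below. Dividing by \<open>t\<close> and letting \<open>t\<close> tend to 0 turns the curvature on
  the segment into the full quadratic term. The sign of \<open>\<mu>\<close> is irrelevant.\<close>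

lemma strongly_convex_subgradient_ineq:
  fixes f :: "'a::real_inner \<Rightarrow> ereal"
  assumes conv: "ext_convex (sub_quadratic \<mu> f)" and g: "g \<in> convex_subdifferential f x"
  shows "f x + ereal (g \<bullet> (y - x) + \<mu> / 2 * (norm (y - x))\<^sup>2) \<le> f y"
proof (cases "f y = \<infinity>")
  case False
  have sub: "f x + ereal (g \<bullet> (z - x)) \<le> f z" for z
    using g by (simp add: convex_subdifferential_def)
  obtain a where a: "f x = ereal a"
    using g by (auto simp: convex_subdifferential_def)
  obtain b where b: "f y = ereal b"
    using False sub[of y] a by (cases "f y") auto
  let ?N = "(norm (y - x))\<^sup>2"
  have "a + g \<bullet> (y - x) + \<mu> / 2 * ?N - b \<le> (\<mu> / 2 * ?N) * t" if t: "0 < t" "t \<le> 1" for t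
  proof -
    let ?w = "(1 - t) *\<^sub>R x + t *\<^sub>R y"
    have "sub_quadratic \<mu> f ?w
        \<le> ereal (1 - t) * sub_quadratic \<mu> f x + ereal t * sub_quadratic \<mu> f y"
      using conv t by (simp add: ext_convex_def)
    moreover have "?w - x = t *\<^sub>R (y - x)"
      by (simp add: algebra_simps)
    then have "ereal (a + t * (g \<bullet> (y - x))) \<le> f ?w"
      using sub[of ?w] a by simp
    ultimately have "a + t * (g \<bullet> (y - x)) - \<mu> / 2 * (norm ?w)\<^sup>2
        \<le> (1 - t) * (a - \<mu> / 2 * (norm x)\<^sup>2) + t * (b - \<mu> / 2 * (norm y)\<^sup>2)"
      by (cases "f ?w") (auto simp: sub_quadratic_def a b)
    then have "t * (a + g \<bullet> (y - x) + \<mu> / 2 * ?N - b) \<le> t * ((\<mu> / 2 * ?N) * t)"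
      unfolding norm_convex_combination_sq by (simp add: field_simps)
    then show ?thesis
      using t(1) by (simp only: mult_le_cancel_left_pos)
  qed
  from nonpos_if_le_mult_all_small[OF this] show ?thesis
    by (simp add: a b)
qed simp

text \<open>Without any differentiability assumption, upper curvature forces a global subgradient at
  \<open>x\<close> to behave like the gradient there.\<close>

lemma smooth_upper_bound:
  fixes h :: "'a::real_inner \<Rightarrow> real"
  assumes conv: "convex_on UNIV (\<lambda>z. L / 2 * (norm z)\<^sup>2 - h z)"
    and sub: "\<And>z. h x + g \<bullet> (z - x) \<le> h z"
  shows "h z \<le> h x + g \<bullet> (z - x) + L / 2 * (norm (z - x))\<^sup>2"
proof -
  let ?v = "z - x"
  have "h z - (h x + g \<bullet> ?v + L / 2 * (norm ?v)\<^sup>2) \<le> (L / 2 * (norm ?v)\<^sup>2) * t"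
    if t: "0 < t" for t :: real
  proof -
    \<comment> \<open>\<open>x\<close> lies between \<open>z\<close> and a point \<open>w\<close> just beyond \<open>x\<close>, where the subgradient bounds \<open>h w\<close> below.\<close>
    let ?w = "x - t *\<^sub>R ?v"
    have x: "x = (1 - t / (1 + t)) *\<^sub>R ?w + (t / (1 + t)) *\<^sub>R z"
    proof -
      have "(1 + t) *\<^sub>R ((1 - t / (1 + t)) *\<^sub>R ?w + (t / (1 + t)) *\<^sub>R z)
          = ((1 + t) * (1 - t / (1 + t))) *\<^sub>R ?w + ((1 + t) * (t / (1 + t))) *\<^sub>R z"
        by (simp only: scaleR_add_right scaleR_scaleR)
      also have "\<dots> = ?w + t *\<^sub>R z"
        using t by (simp add: right_diff_distrib)
      also have "\<dots> = (1 + t) *\<^sub>R x"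
        by (simp add: algebra_simps)
      finally show ?thesis
        using t by simp
    qed
    have tt: "0 \<le> t / (1 + t)" "t / (1 + t) \<le> 1" and c: "1 - t / (1 + t) = 1 / (1 + t)"
      using t by (simp_all add: field_simps)
    from convex_onD[OF conv tt UNIV_I UNIV_I, of ?w z]
    have "L / 2 * (norm x)\<^sup>2 - h x \<le> (1 - t / (1 + t)) * (L / 2 * (norm ?w)\<^sup>2 - h ?w)
        + t / (1 + t) * (L / 2 * (norm z)\<^sup>2 - h z)"
      by (simp only: x[symmetric])
    also have "\<dots> = (L / 2 * (norm ?w)\<^sup>2 - h ?w + t * (L / 2 * (norm z)\<^sup>2 - h z)) / (1 + t)"
      unfolding c by (simp only: add_divide_distrib mult_1 times_divide_eq_left)
    finally have "(1 + t) * (L / 2 * (norm x)\<^sup>2 - h x)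
        \<le> L / 2 * (norm ?w)\<^sup>2 - h ?w + t * (L / 2 * (norm z)\<^sup>2 - h z)"
      using t by (simp only: pos_le_divide_eq add_pos_pos zero_less_one mult.commute)
    moreover have "h x - t * (g \<bullet> ?v) \<le> h ?w"
      using sub[of ?w] by simp
    \<comment> \<open>The factor \<open>t\<close> cancels below. Of the remaining
      \<open>1 + t\<close>, the 1 yields the quadratic term of the bound and the \<open>t\<close> is
      the error that vanishes in the limit.\<close>
    moreover have "(norm ?w)\<^sup>2 + t * (norm z)\<^sup>2 - (1 + t) * (norm x)\<^sup>2 = t * (1 + t) * (norm ?v)\<^sup>2"
      unfolding power2_norm_eq_inner
      by (simp add: inner_diff_left inner_diff_right inner_commute[of z x]) algebra
    then have "L / 2 * (norm ?w)\<^sup>2 + t * (L / 2 * (norm z)\<^sup>2) - (1 + t) * (L / 2 * (norm x)\<^sup>2)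
        = L / 2 * (t * (1 + t) * (norm ?v)\<^sup>2)"
      by algebra
    ultimately have "t * (h z - (h x + g \<bullet> ?v + L / 2 * (norm ?v)\<^sup>2)) \<le> t * ((L / 2 * (norm ?v)\<^sup>2) * t)"
      by (simp add: algebra_simps)
    then show ?thesis
      using t by (simp only: mult_le_cancel_left_pos)
  qed
  from nonpos_if_le_mult_all_small[OF this] show ?thesis
    by simp
qed

text \<open>Both bounds are tested at a common third point. Choosing \<open>x\<close> itself would
  give only the strong convexity term; moving away from \<open>x\<close> gains the last
  square.\<close>

lemma interpolation_ineq:
  fixes h :: "'a::real_inner \<Rightarrow> real"
  assumes L: "\<mu> < L"
    and lower: "\<And>z. h y + g' \<bullet> (z - y) + \<mu> / 2 * (norm (z - y))\<^sup>2 \<le> h z"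
    and upper: "\<And>z. h z \<le> h x + g \<bullet> (z - x) + L / 2 * (norm (z - x))\<^sup>2"
  shows "h x - h y \<ge> g' \<bullet> (x - y) + \<mu> / 2 * (norm (x - y))\<^sup>2
    + (norm (g - g' - \<mu> *\<^sub>R (x - y)))\<^sup>2 / (2 * (L - \<mu>))"
proof -
  \<comment> \<open>\<open>z\<close> minimises the gap between the upper and the lower quadratic bound.\<close>
  define p where "p = g - g' - \<mu> *\<^sub>R (x - y)"
  define s where "s = - (1 / (L - \<mu>)) *\<^sub>R p"
  define z where "z = x + s"
  have zx: "z - x = s" and zy: "z - y = (x - y) + s"
    by (simp_all add: z_def)
  have "h x - h y \<ge> g' \<bullet> (z - y) + \<mu> / 2 * (norm (z - y))\<^sup>2 - g \<bullet> (z - x) - L / 2 * (norm (z - x))\<^sup>2"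
    using lower[of z] upper[of z] by linarith
  also have "g' \<bullet> (z - y) + \<mu> / 2 * (norm (z - y))\<^sup>2 - g \<bullet> (z - x) - L / 2 * (norm (z - x))\<^sup>2
     = g' \<bullet> (x - y) + \<mu> / 2 * (norm (x - y))\<^sup>2 - p \<bullet> s - (L - \<mu>) / 2 * (s \<bullet> s)"
  proof -
    have "(norm ((x - y) + s))\<^sup>2 = (norm (x - y))\<^sup>2 + 2 * ((x - y) \<bullet> s) + s \<bullet> s"
      unfolding power2_norm_eq_inner inner_add_left inner_add_right inner_commute[of s "x - y"] by simp
    moreover have "p \<bullet> s = g \<bullet> s - g' \<bullet> s - \<mu> * ((x - y) \<bullet> s)"
      unfolding p_def inner_diff_left[of _ _ s] inner_scaleR_left ..
    ultimately show ?thesis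
      unfolding zx zy inner_add_right by (simp add: power2_norm_eq_inner[of s] field_simps)
  qed
  finally have "h x - h y
      \<ge> g' \<bullet> (x - y) + \<mu> / 2 * (norm (x - y))\<^sup>2 - p \<bullet> s - (L - \<mu>) / 2 * (s \<bullet> s)" .
  moreover have "- (p \<bullet> s) - (L - \<mu>) / 2 * (s \<bullet> s) = (norm p)\<^sup>2 / (2 * (L - \<mu>))"
    using L by (simp add: s_def power2_norm_eq_inner divide_simps)
  ultimately show ?thesis
    unfolding p_def[symmetric] by linarith
qed

lemma two_step_quadratic_bound:
  fixes g d e :: "'a::real_inner"
  assumes "0 \<le> \<mu>1" "\<mu>1 \<le> \<mu>2" and mono: "g \<bullet> e \<ge> \<mu>2 * (norm e)\<^sup>2"
  shows "\<mu>2 * (\<mu>2 - \<mu>1) * (norm e)\<^sup>2 \<le> (norm (g - \<mu>1 *\<^sub>R d))\<^sup>2 + \<mu>1 * (\<mu>2 - \<mu>1) * (norm d)\<^sup>2"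
\<comment> \<open>The main argument ends by cancelling \<open>\<mu>2\<close>. If it is zero, so is
  \<open>\<mu>1\<close>, and the left side vanishes.\<close>
proof (cases "\<mu>2 = 0")
  case True
  then show ?thesis using assms by simp
next
  case False
  with assms have pos: "0 < \<mu>2" by simp
  have "\<mu>2 * norm e \<le> norm g"
  proof (cases "e = 0")
    case False
    have "(\<mu>2 * norm e) * norm e \<le> norm g * norm e"
      using mono norm_cauchy_schwarz[of g e] by (simp add: power2_eq_square)
    then show ?thesis using False by simp
  qed simp
  then have "(\<mu>2 * norm e)\<^sup>2 \<le> (norm g)\<^sup>2"
    using pos by (intro power_mono) auto
  then have "(\<mu>2 - \<mu>1) * (\<mu>2 * norm e)\<^sup>2 \<le> (\<mu>2 - \<mu>1) * (norm g)\<^sup>2"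
    using assms by (intro mult_left_mono) auto
  also have "\<dots> \<le> (\<mu>2 - \<mu>1) * (norm g)\<^sup>2 + \<mu>1 * (norm (g - \<mu>2 *\<^sub>R d))\<^sup>2"
    using assms by simp
  also have "\<dots> = \<mu>2 * ((norm (g - \<mu>1 *\<^sub>R d))\<^sup>2 + \<mu>1 * (\<mu>2 - \<mu>1) * (norm d)\<^sup>2)"
    unfolding power2_norm_eq_inner
    by (simp add: inner_diff_left inner_diff_right inner_commute[of d g]) algebra
  finally have "\<mu>2 * (\<mu>2 * (\<mu>2 - \<mu>1) * (norm e)\<^sup>2)
      \<le> \<mu>2 * ((norm (g - \<mu>1 *\<^sub>R d))\<^sup>2 + \<mu>1 * (\<mu>2 - \<mu>1) * (norm d)\<^sup>2)"
    by (simp add: power2_eq_square mult_ac)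
  then show ?thesis
    using pos by (simp only: mult_le_cancel_left_pos)
qed

lemma arg_min_subgradient:
  fixes f :: "'a::real_inner \<Rightarrow> ereal"
  assumes "proper f" and min: "is_arg_min (\<lambda>w. f w - ereal (g \<bullet> w)) (\<lambda>w. w \<in> UNIV) x"
  shows "g \<in> convex_subdifferential f x"
proof -
  have le: "f x - ereal (g \<bullet> x) \<le> f y - ereal (g \<bullet> y)" for y
    using min by (auto simp: is_arg_min_def not_less)
  obtain y where y: "f y \<noteq> \<infinity>"
    using assms(1) by (auto simp: proper_def)
  have ninf: "f z \<noteq> - \<infinity>" for z
    using assms(1) by (auto simp: proper_def)
  \<comment> \<open>The minimal value is finite because it is compared with that at a point
    \<open>y\<close> where \<open>f\<close> is finite.\<close>
  obtain a where a: "f x = ereal a"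
    using le[of y] y ninf[of x] ninf[of y] by (cases "f x"; cases "f y") auto
  have "f x + ereal (g \<bullet> (z - x)) \<le> f z" for z
    using le[of z] a ninf[of z] by (cases "f z") (auto simp: inner_diff_right)
  then show ?thesis
    by (simp add: convex_subdifferential_def a)
qed

theorem lemma3:
  fixes f1 f2 :: "'a::euclidean_space \<Rightarrow> ereal"
    and \<mu>1 \<mu>2 :: real and L1 L2 :: ereal
    and x0 x1 x2 :: 'a
  assumes "dc_assumption \<mu>1 L1 \<mu>2 L2 f1 f2"
    and "ereal \<mu>2 < L1" and "\<mu>1 \<le> \<mu>2" and "0 \<le> \<mu>1"
    and "x0 \<in> subdiff_dom \<mu>1 f1"
    and "dca_step \<mu>2 f1 f2 x0 x1"
    and "dca_step \<mu>2 f1 f2 x1 x2"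
  shows "dc_objective f1 f2 x1 - dc_objective f1 f2 x2 \<ge>
    ereal (at_curvature (\<lambda>L.
        \<mu>2 * ((\<mu>2 - \<mu>1) / (L - \<mu>1)) * (1/2 * (norm (x0 - x1))\<^sup>2)
      + (\<mu>2 + \<mu>1 * ((L - \<mu>2) / (L - \<mu>1))) * (1/2 * (norm (x1 - x2))\<^sup>2)) L1)"
proof -
  have f1: "f1 \<in> curvature_class \<mu>1 L1" and f2: "f2 \<in> curvature_class \<mu>2 L2"
    and L1: "ereal \<mu>1 < L1" and dom: "subdiff_dom \<mu>1 f1 \<subseteq> subdiff_dom \<mu>2 f2"
    using assms(1) by (auto simp: dc_assumption_def)
  have proper1: "proper f1" and conv1: "ext_convex (sub_quadratic \<mu>1 f1)"
    and conv2: "ext_convex (sub_quadratic \<mu>2 f2)"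
    using f1 f2 by (auto simp: curvature_class_def)
  have subdiff1: "subdifferential \<mu>1 f = convex_subdifferential f"
    and subdiff2: "subdifferential \<mu>2 f = convex_subdifferential f" for f :: "'a \<Rightarrow> ereal"
    using assms(3,4) by (auto simp: subdifferential_def)
  obtain g0 where g0: "g0 \<in> convex_subdifferential f2 x0" "g0 \<in> convex_subdifferential f1 x1"
    using assms(6) arg_min_subgradient[OF proper1] by (auto simp: dca_step_def subdiff2)
  obtain g1 where g1: "g1 \<in> convex_subdifferential f2 x1" "g1 \<in> convex_subdifferential f1 x2"
    using assms(7) arg_min_subgradient[OF proper1] by (auto simp: dca_step_def subdiff2)
  \<comment> \<open>No chosen subgradient of \<open>f2\<close> sits at \<open>x2\<close>, so
    finiteness of \<open>f2\<close> there comes from the domain inclusion.\<close>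
  have "x2 \<in> subdiff_dom \<mu>2 f2"
    using g1(2) dom by (auto simp: subdiff_dom_def subdiff1)
  then obtain a1 a2 b0 b1 b2 where
    fin: "f1 x1 = ereal a1" "f1 x2 = ereal a2" "f2 x0 = ereal b0" "f2 x1 = ereal b1" "f2 x2 = ereal b2"
    using g0 g1 by (force simp: subdiff_dom_def subdiff2 convex_subdifferential_def)
  define g d e where "g = g0 - g1" and "d = x1 - x2" and "e = x0 - x1"
  note low1 = strongly_convex_subgradient_ineq[OF conv1] and low2 = strongly_convex_subgradient_ineq[OF conv2]
  have f2_low: "b2 - b1 \<ge> - (g1 \<bullet> d) + \<mu>2 / 2 * (norm d)\<^sup>2"
    using low2[OF g1(1), of x2] by (simp add: fin d_def inner_diff_right norm_minus_commute)
  have f1_low: "a1 - a2 \<ge> g1 \<bullet> d + \<mu>1 / 2 * (norm d)\<^sup>2"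
    using low1[OF g1(2), of x1] by (simp add: fin d_def)
  \<comment> \<open>Sum of the strong convexity inequalities of \<open>f2\<close> from
    \<open>x1\<close> to \<open>x0\<close> and back; the function values cancel.\<close>
  have mono: "g \<bullet> e \<ge> \<mu>2 * (norm e)\<^sup>2"
    using low2[OF g1(1), of x0] low2[OF g0(1), of x1]
    by (simp add: fin g_def e_def inner_diff_right inner_diff_left norm_minus_commute)
  have "(a1 - b1) - (a2 - b2) \<ge> at_curvature (\<lambda>L.
        \<mu>2 * ((\<mu>2 - \<mu>1) / (L - \<mu>1)) * (1/2 * (norm e)\<^sup>2)
      + (\<mu>2 + \<mu>1 * ((L - \<mu>2) / (L - \<mu>1))) * (1/2 * (norm d)\<^sup>2)) L1" (is "_ \<ge> at_curvature ?\<phi> _")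
  proof (cases L1)
    case PInf
    have "((\<lambda>L. \<mu>2 * ((\<mu>2 - \<mu>1) / (L - \<mu>1)) * (1/2 * (norm e)\<^sup>2)
        + (\<mu>2 + \<mu>1 * ((L - \<mu>2) / (L - \<mu>1))) * (1/2 * (norm d)\<^sup>2)) \<longlongrightarrow>
        \<mu>2 * 0 * (1/2 * (norm e)\<^sup>2) + (\<mu>2 + \<mu>1 * 1) * (1/2 * (norm d)\<^sup>2)) at_top"
      by (intro tendsto_intros; real_asymp)
    then have "Lim at_top ?\<phi> = (\<mu>2 + \<mu>1) * (1/2 * (norm d)\<^sup>2)"
      by (intro tendsto_Lim) simp_all
    then show ?thesis
      using f1_low f2_low by (simp add: at_curvature_def PInf algebra_simps)
  next
    case (real L)
    then have L: "\<mu>1 < L" using L1 by simp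
    \<comment> \<open>A finite \<open>L1\<close> makes \<open>f1\<close> real-valued, so the bounds
      for real functions apply.\<close>
    define h where "h z = real_of_ereal (f1 z)" for z
    have h: "f1 z = ereal (h z)" for z
      using f1 real by (simp add: curvature_class_def h_def ereal_real)
    have conv: "convex_on UNIV (\<lambda>z. L / 2 * (norm z)\<^sup>2 - h z)"
      using f1 real by (simp add: curvature_class_def h_def)
    obtain k where k: "L = \<mu>1 + k" "0 < k"
      using L that[of "L - \<mu>1"] by simp
    have "h x1 + g0 \<bullet> (z - x1) \<le> h z" for z
      using g0(2) by (simp add: convex_subdifferential_def h)
    note upper = smooth_upper_bound[OF conv this]
    have lower: "h x2 + g1 \<bullet> (z - x2) + \<mu>1 / 2 * (norm (z - x2))\<^sup>2 \<le> h z" for z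
      using low1[OF g1(2), of z] by (simp add: h)
    have "h x1 = a1" "h x2 = a2"
      using fin h by simp_all
    with interpolation_ineq[OF L lower upper]
    have "a1 - a2 \<ge> g1 \<bullet> d + \<mu>1 / 2 * (norm d)\<^sup>2 + (norm (g - \<mu>1 *\<^sub>R d))\<^sup>2 / (2 * (L - \<mu>1))"
      by (simp add: g_def d_def)
    moreover have "(norm (g - \<mu>1 *\<^sub>R d))\<^sup>2 / (2 * (L - \<mu>1))
        \<ge> (\<mu>2 * (\<mu>2 - \<mu>1) * (norm e)\<^sup>2 - \<mu>1 * (\<mu>2 - \<mu>1) * (norm d)\<^sup>2) / (2 * (L - \<mu>1))"
      using two_step_quadratic_bound[OF assms(4,3) mono, of d] L by (intro divide_right_mono) auto
    \<comment> \<open>Uses (L - \<mu>2) / (L - \<mu>1) = 1 - (\<mu>2 - \<mu>1) / (L - \<mu>1);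
      writing \<open>L\<close> as \<open>\<mu>1 + k\<close> makes the denominator a single positive
      variable.\<close>
    moreover have "?\<phi> L = (\<mu>1 + \<mu>2) / 2 * (norm d)\<^sup>2
        + (\<mu>2 * (\<mu>2 - \<mu>1) * (norm e)\<^sup>2 - \<mu>1 * (\<mu>2 - \<mu>1) * (norm d)\<^sup>2) / (2 * (L - \<mu>1))"
      using k by (simp add: field_simps)
    ultimately show ?thesis
      using f2_low by (simp add: at_curvature_def real algebra_simps add_divide_distrib)
  next
    case MInf
    then show ?thesis using L1 by simp
  qed
  then show ?thesis
    by (simp add: dc_objective_def fin d_def e_def)
qed

end
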